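(* Let $0<\Lambda_1\le\Lambda_2<\infty$ and let $\Omega\subset\mathbb R^n$ be a bounded domain. Assume that $\lambda(x),c(x)\in L^\infty(\Omega)$, $\gamma\ge0$, and that $\psi\in C^2(\Omega)\cap C^1(\overline\Omega)$ is positive in $\overline\Omega$ and satisfies $$\mathcal M^+_{\Lambda_1,\Lambda_2}(D^2\psi)+\lambda(x)\psi\le0\quad\text{in }\Omega.$$ Let $u\in C(\overline\Omega)$ be a viscosity solution of $$\mathcal M^-_{\Lambda_1,\Lambda_2}(D^2u)-\gamma|Du|+c(x)u\le0\ \text{ in }\Omega,\qquad u\ge0\ \text{ on }\partial\Omega.$$ If $$c(x)\le\lambda(x)-\gamma\,\frac{|D\psi(x)|}{\psi(x)}\quad\text{for } x\in\Omega,$$ then $u\ge0$ in $\Omega$.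
   Context: For a real symmetric $n\times n$ matrix $M$ with eigenvalues $e_1,\dots,e_n$, the Pucci extremal operators are $$\mathcal M^+_{\Lambda_1,\Lambda_2}(M)=\Lambda_2\sum_{e_i>0}e_i+\Lambda_1\sum_{e_i<0}e_i,\qquad \mathcal M^-_{\Lambda_1,\Lambda_2}(M)=\Lambda_1\sum_{e_i>0}e_i+\Lambda_2\sum_{e_i<0}e_i.$$ A continuous function $u$ is a viscosity solution of the inequality $\mathcal M^-_{\Lambda_1,\Lambda_2}(D^2u)-\gamma|Du|+c(x)u\le0$ in $\Omega$ if, whenever $x_0\in\Omega$, $\phi\in C^2(\Omega)$ and $u-\phi$ has a local minimum at $x_0$, one has $\mathcal M^-_{\Lambda_1,\Lambda_2}(D^2\phi(x_0))-\gamma|D\phi(x_0)|+c(x_0)u(x_0)\le0$. The coefficients $c,\lambda$ are bounded functions defined pointwise on $\Omega$. *)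

theory Defs
  imports "HOL-Analysis.Analysis" "HOL-Computational_Algebra.Polynomial"
begin

definition charpoly :: "real ^ 'n ^ 'n \<Rightarrow> real poly" where
  "charpoly M = det (\<chi> i j. (if i = j then [:0, 1:] else 0) - [: M $ i $ j :])"

(* A real matrix need not have CARD('n) real eigenvalues, but a symmetric one does; the
   operators below are only meant for symmetric matrices, such as Hessians of C2 functions. *)
definition eigenvalues :: "real ^ 'n ^ 'n \<Rightarrow> real multiset" where
  "eigenvalues M = proots (charpoly M)"

definition pucci_max :: "real \<Rightarrow> real \<Rightarrow> real ^ 'n ^ 'n \<Rightarrow> real" where
  "pucci_max \<Lambda>1 \<Lambda>2 M =
     \<Lambda>2 * (\<Sum>e\<in>#filter_mset (\<lambda>e. e > 0) (eigenvalues M). e)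
   + \<Lambda>1 * (\<Sum>e\<in>#filter_mset (\<lambda>e. e < 0) (eigenvalues M). e)"

definition pucci_min :: "real \<Rightarrow> real \<Rightarrow> real ^ 'n ^ 'n \<Rightarrow> real" where
  "pucci_min \<Lambda>1 \<Lambda>2 M =
     \<Lambda>1 * (\<Sum>e\<in>#filter_mset (\<lambda>e. e > 0) (eigenvalues M). e)
   + \<Lambda>2 * (\<Sum>e\<in>#filter_mset (\<lambda>e. e < 0) (eigenvalues M). e)"

definition gradient :: "(real ^ 'n \<Rightarrow> real) \<Rightarrow> real ^ 'n \<Rightarrow> real ^ 'n" where
  "gradient f x = (\<chi> i. frechet_derivative f (at x) (axis i 1))"

definition hessian :: "(real ^ 'n \<Rightarrow> real) \<Rightarrow> real ^ 'n \<Rightarrow> real ^ 'n ^ 'n" where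
  "hessian f x = jacobian (gradient f) (at x)"

(* For open S.  Continuity of f and of its gradient follows from differentiability. *)
definition C2_on :: "(real ^ 'n) set \<Rightarrow> (real ^ 'n \<Rightarrow> real) \<Rightarrow> bool" where
  "C2_on S f \<longleftrightarrow>
     (\<forall>x\<in>S. f differentiable (at x)) \<and>
     (\<forall>x\<in>S. gradient f differentiable (at x)) \<and>
     continuous_on S (hessian f)"

(* For open S: C1 in S, with f and its gradient extending continuously to the closure. *)
definition C1_closure :: "(real ^ 'n) set \<Rightarrow> (real ^ 'n \<Rightarrow> real) \<Rightarrow> bool" where
  "C1_closure S f \<longleftrightarrow>
     continuous_on (closure S) f \<and>
     (\<forall>x\<in>S. f differentiable (at x)) \<and>
     (\<exists>G. continuous_on (closure S) G \<and> (\<forall>x\<in>S. G x = gradient f x))"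

(* Coefficients enter viscosity inequalities pointwise, so an element of L-infinity is a
   measurable function that is bounded everywhere on S, not a class modulo null sets. *)
definition Linfty :: "(real ^ 'n) set \<Rightarrow> (real ^ 'n \<Rightarrow> real) \<Rightarrow> bool" where
  "Linfty S f \<longleftrightarrow> f \<in> borel_measurable (lebesgue_on S) \<and> bounded (f ` S)"

(* u solves F(x, u, Du, D^2 u) \<le> 0 in the open set S in the viscosity sense. *)
definition viscosity_le_zero ::
  "(real ^ 'n \<Rightarrow> real \<Rightarrow> real ^ 'n \<Rightarrow> real ^ 'n ^ 'n \<Rightarrow> real) \<Rightarrow>
   (real ^ 'n) set \<Rightarrow> (real ^ 'n \<Rightarrow> real) \<Rightarrow> bool" where
  "viscosity_le_zero F S u \<longleftrightarrow>
     continuous_on S u \<and>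
     (\<forall>x0\<in>S. \<forall>\<phi>. C2_on S \<phi> \<longrightarrow>
        (\<forall>\<^sub>F y in at x0 within S. u x0 - \<phi> x0 \<le> u y - \<phi> y) \<longrightarrow>
        F x0 (u x0) (gradient \<phi> x0) (hessian \<phi> x0) \<le> 0)"

end

theory Submission
  imports Defs
begin

text \<open>
  Divide \<open>u\<close> by the positive supersolution \<open>\<psi>\<close>. Suppose \<open>u / \<psi>\<close> is negative somewhere. At a
  negative minimum \<open>- k\<close>, attained inside \<open>\<Omega>\<close> because of the boundary values, the function
  \<open>- k * \<psi>\<close> touches \<open>u\<close> from below, and the viscosity inequality reads
  \<open>pucci_max (D\<^sup>2\<psi>) + \<gamma> * norm (D\<psi>) + c * \<psi> \<ge> 0\<close>, by \<open>pucci_min (- X) = - pucci_max X\<close>. The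
  equation for \<open>\<psi>\<close> and the bound on \<open>c\<close> say exactly the opposite weak inequality \<open>\<le> 0\<close>,
  so the contradiction is missed only by the equality case.

  Strictness comes from a barrier: instead of a constant, \<open>u / \<psi>\<close> is compared with
  \<open>v x = \<epsilon> * exp (b \<bullet> x) - k\<close> for a small \<open>\<epsilon>\<close> and a long vector \<open>b\<close> (lemma \<open>touching_point\<close>).
  The test function \<open>\<psi> * v\<close> has Hessian
  \<open>v D\<^sup>2\<psi> + \<psi> D\<^sup>2v + D\<psi> \<otimes> Dv + Dv \<otimes> D\<psi>\<close>. The convex term \<open>\<psi> D\<^sup>2v\<close> is of order \<open>(norm b)\<^sup>2\<close>,
  while the mixed terms and the drift are only of order \<open>norm b\<close>. Since \<open>\<psi>\<close> is bounded
  below and \<open>D\<psi>\<close> is bounded, a single \<open>b\<close> makes \<open>\<psi> * v\<close> a strict subsolution wherever \<open>v < 0\<close>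
  (lemma \<open>barrier_strict_subsolution\<close>), and a strict subsolution cannot touch \<open>u\<close> from below.

  The estimate of \<open>pucci_min\<close> on such a sum (lemma \<open>pucci_min_perturbation\<close>) is taken in an
  orthonormal eigenframe of the whole sum. It rests on the spectral theorem, which
  identifies the multiset of roots of the characteristic polynomial, on Jensen's inequality
  for the diagonal entries of a symmetric matrix (lemma \<open>pucci_max_ge_frame_sum\<close>), and on the
  symmetry of the Hessian.
\<close>

section \<open>Real symmetric matrices and orthonormal frames\<close>

text \<open>
  Frames are indexed by the coordinate type itself: a family satisfying this is then an
  orthonormal basis, its vectors are the rows of an orthogonal matrix, and traces become sums
  over the same index type as the coordinates.
\<close>

definition orthonormal_frame :: "('n \<Rightarrow> real ^ 'n) \<Rightarrow> bool" where
  "orthonormal_frame w \<longleftrightarrow> (\<forall>i j. w i \<bullet> w j = (if i = j then 1 else 0))"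

lemma orthonormal_frame_matrix:
  assumes "orthonormal_frame w"
  shows "orthogonal_matrix (\<chi> i. w i)"
  using assms
  by (auto simp: orthonormal_frame_def orthogonal_matrix_orthonormal_rows row_def norm_eq_1 orthogonal_def vec_lambda_eta)

lemma orthonormal_frame_parseval:
  assumes "orthonormal_frame w"
  shows "x \<bullet> y = (\<Sum>i\<in>UNIV. (x \<bullet> w i) * (y \<bullet> w i))"
proof -
  let ?Q = "\<chi> i. w i"
  have "transpose ?Q ** ?Q = mat 1"
    using orthonormal_frame_matrix[OF assms] by (simp add: orthogonal_matrix)
  then have "x \<bullet> y = (?Q *v x) \<bullet> (?Q *v y)"
    by (metis dot_lmul_matrix matrix_vector_mul_assoc matrix_vector_mul_lid transpose_matrix_vector)
  also have "\<dots> = (\<Sum>i\<in>UNIV. (x \<bullet> w i) * (y \<bullet> w i))"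
    by (simp add: inner_vec_def[of "?Q *v x"] matrix_vector_mul_component inner_commute)
  finally show ?thesis .
qed

lemma symmetric_matrix_inner:
  fixes A :: "real ^ 'n ^ 'n"
  assumes "transpose A = A"
  shows "x \<bullet> (A *v y) = (A *v x) \<bullet> y"
  using assms by (metis dot_lmul_matrix transpose_matrix_vector)

text \<open>
  The first-order condition at a maximum, in purely algebraic form: for a small \<open>s\<close> of the
  sign of \<open>p\<close>, the linear term would dominate the quadratic one.
\<close>

lemma nonpos_quadratic_linear_part:
  fixes p q :: real
  assumes "\<And>s. s * p + s\<^sup>2 * q \<le> 0"
  shows "p = 0"
proof (rule ccontr)
  assume "p \<noteq> 0"
  \<comment> \<open>This step size keeps the quadratic term strictly below the linear one.\<close>
  define s where "s = p / (\<bar>q\<bar> + 1)"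
  have "s * p + s\<^sup>2 * q = p\<^sup>2 * (\<bar>q\<bar> + 1 + q) / (\<bar>q\<bar> + 1)\<^sup>2"
  proof -
    have "\<bar>q\<bar> + 1 \<noteq> 0" by linarith
    moreover have "s * p + s\<^sup>2 * q = p\<^sup>2 / r + p\<^sup>2 * q / r\<^sup>2" if "r = \<bar>q\<bar> + 1" for r
      by (simp add: s_def that[symmetric] power2_eq_square)
    moreover have "p\<^sup>2 / r + p\<^sup>2 * q / r\<^sup>2 = p\<^sup>2 * (r + q) / r\<^sup>2" if "r \<noteq> 0" for r
      using that by (simp add: power2_eq_square field_simps)
    ultimately show ?thesis by metis
  qed
  moreover have "p\<^sup>2 * (\<bar>q\<bar> + 1 + q) / (\<bar>q\<bar> + 1)\<^sup>2 > 0"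
    using \<open>p \<noteq> 0\<close> by (intro divide_pos_pos mult_pos_pos) auto
  ultimately show False using assms[of s] by linarith
qed

text \<open>
  A maximiser of the Rayleigh quotient over the unit vectors of the subspace is an
  eigenvector. Maximality makes the derivative of the quotient vanish in every direction of
  the subspace, so the residual \<open>A v - e v\<close> is orthogonal to the subspace; by invariance
  it also lies in it, hence it is zero.
\<close>

lemma symmetric_eigenvector_in_invariant_subspace:
  fixes A :: "real ^ 'n ^ 'n"
  assumes sym: "transpose A = A" and S: "subspace S" and "S \<noteq> {0}"
    and inv: "\<And>x. x \<in> S \<Longrightarrow> A *v x \<in> S"
  obtains v e where "v \<in> S" "norm v = 1" "A *v v = e *\<^sub>R v"
proof -
  let ?K = "S \<inter> sphere 0 1"
  obtain x where x: "x \<in> S" "x \<noteq> 0" using assms(3) subspace_0[OF S] by blast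
  then have "(1 / norm x) *\<^sub>R x \<in> ?K" using S by (auto simp: subspace_scale)
  then have ne: "?K \<noteq> {}" by blast
  have cpt: "compact ?K"
    by (intro closed_Int_compact closed_subspace S compact_sphere)
  have "continuous_on ?K (\<lambda>x. x \<bullet> (A *v x))"
    by (intro continuous_intros matrix_vector_mult_linear_continuous_on)
  then obtain v where v: "v \<in> ?K" and vmax: "\<And>y. y \<in> ?K \<Longrightarrow> y \<bullet> (A *v y) \<le> v \<bullet> (A *v v)"
    using continuous_attains_sup[OF cpt ne] by blast
  define e where "e = v \<bullet> (A *v v)"
  have le: "y \<bullet> (A *v y) \<le> e * (y \<bullet> y)" if "y \<in> S" for y
  proof (cases "y = 0")
    case False
    let ?z = "(1 / norm y) *\<^sub>R y"
    have "?z \<in> ?K" using that False S by (auto simp: subspace_scale)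
    then have "?z \<bullet> (A *v ?z) \<le> e" using vmax e_def by blast
    then have "(y \<bullet> (A *v y)) / (norm y)\<^sup>2 \<le> e"
      by (simp add: linear_scale[OF matrix_vector_mul_linear] power2_eq_square)
    then show ?thesis using False by (simp add: dot_square_norm pos_divide_le_eq)
  qed simp
  have vv: "v \<bullet> v = 1" "v \<in> S" using v by (auto simp: dot_square_norm)
  have orth: "y \<bullet> (A *v v - e *\<^sub>R v) = 0" if "y \<in> S" for y
  proof -
    have "s * (2 * (y \<bullet> (A *v v - e *\<^sub>R v))) + s\<^sup>2 * (y \<bullet> (A *v y) - e * (y \<bullet> y)) \<le> 0" for s
    proof -
      have "v + s *\<^sub>R y \<in> S" using S that vv by (simp add: subspace_add subspace_scale)
      from le[OF this] show ?thesis
        using symmetric_matrix_inner[OF sym, of v y] vv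
        by (simp add: matrix_vector_right_distrib linear_scale[OF matrix_vector_mul_linear]
            inner_simps e_def[symmetric] power2_eq_square inner_commute algebra_simps)
    qed
    from nonpos_quadratic_linear_part[OF this] show ?thesis by simp
  qed
  have "A *v v - e *\<^sub>R v \<in> S" using inv vv S by (simp add: subspace_diff subspace_scale)
  from orth[OF this] have "A *v v = e *\<^sub>R v" by simp
  then show thesis using that[of v e] v by simp
qed

text \<open>
  A largest orthonormal set of eigenvectors is a basis: its orthogonal complement is invariant
  because the matrix is symmetric, so a nonzero complement would contain a further unit
  eigenvector.
\<close>

lemma spectral_theorem_real:
  fixes A :: "real ^ 'n ^ 'n"
  assumes sym: "transpose A = A"
  obtains w e where "orthonormal_frame w" "\<And>i. A *v w i = e i *\<^sub>R w i"
proof -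
  let ?P = "\<lambda>B. pairwise orthogonal B \<and> (\<forall>v\<in>B. norm v = 1 \<and> (\<exists>e. A *v v = e *\<^sub>R v))"
  have indep: "independent B" if "?P B" for B
    using that by (intro pairwise_orthogonal_independent) auto
  have bound: "card B \<le> CARD('n)" if "?P B" for B
    using independent_bound[OF indep[OF that]] by simp
  have "?P {}" by simp
  moreover have "\<forall>B. ?P B \<longrightarrow> card B < Suc CARD('n)" using bound by (simp add: less_Suc_eq_le)
  ultimately have "\<exists>B. ?P B \<and> (\<forall>C. ?P C \<longrightarrow> card C \<le> card B)"
    by (rule ex_has_greatest_nat[of ?P "{}" card])
  then obtain B where B: "?P B" and Bmax: "\<And>C. ?P C \<Longrightarrow> card C \<le> card B"
    by blast
  have fin: "finite B" using independent_bound[OF indep[OF B]] by blast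
  let ?S = "{x. \<forall>b\<in>B. b \<bullet> x = 0}"
  have "?S = {0}"
  proof (rule ccontr)
    assume ne: "?S \<noteq> {0}"
    have "subspace ?S" by (auto simp: subspace_def inner_simps)
    moreover have inv: "A *v x \<in> ?S" if "x \<in> ?S" for x
    proof -
      have "b \<bullet> (A *v x) = 0" if "b \<in> B" for b
      proof -
        have "\<exists>e. A *v b = e *\<^sub>R b" using B \<open>b \<in> B\<close> by auto
        then obtain e where "A *v b = e *\<^sub>R b" by (elim exE)
        moreover have "b \<bullet> x = 0" using \<open>x \<in> ?S\<close> \<open>b \<in> B\<close> by auto
        ultimately show ?thesis by (simp only: symmetric_matrix_inner[OF sym, of b x] inner_scaleR_left mult_zero_right)
      qed
      then show ?thesis by simp
    qed
    ultimately obtain v e where v: "v \<in> ?S" "norm v = 1" "A *v v = e *\<^sub>R v"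
      by (rule symmetric_eigenvector_in_invariant_subspace[OF sym _ ne])
    have "v \<notin> B" using v by auto
    have "?P (insert v B)" using B v
      by (auto simp: pairwise_insert orthogonal_def inner_commute)
    from Bmax[OF this] show False using fin \<open>v \<notin> B\<close> by simp
  qed
  have "span B = UNIV"
  proof (rule ccontr)
    assume "span B \<noteq> UNIV"
    then have "span B \<subset> span UNIV" by auto
    then obtain x where "x \<noteq> 0" "\<And>y. y \<in> span B \<Longrightarrow> orthogonal x y"
      using orthogonal_to_subspace_exists_gen by metis
    then have "x \<in> ?S" by (auto simp: orthogonal_def inner_commute span_base)
    with \<open>?S = {0}\<close> \<open>x \<noteq> 0\<close> show False by blast
  qed
  then have "card B = CARD('n)"
    using dim_eq_card_independent[OF indep[OF B]] by (metis dim_UNIV dim_span DIM_cart DIM_real mult_1_right)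
  then obtain w where w: "bij_betw w (UNIV :: 'n set) B"
    using finite_same_card_bij[OF finite_class.finite_UNIV fin] by auto
  have "\<exists>e. A *v w i = e *\<^sub>R w i" for i using w B by (auto simp: bij_betw_def)
  then obtain e where "\<And>i. A *v w i = e i *\<^sub>R w i" by metis
  moreover have "orthonormal_frame w"
    unfolding orthonormal_frame_def
  proof (intro allI)
    fix i j
    have "w i \<in> B" "w j \<in> B" using w by (auto simp: bij_betw_def)
    moreover have "w i \<noteq> w j" if "i \<noteq> j" using w that by (auto simp: bij_betw_def inj_def)
    ultimately show "w i \<bullet> w j = (if i = j then 1 else 0)"
      using B by (auto simp: pairwise_def orthogonal_def norm_eq_1)
  qed
  ultimately show thesis using that by blast
qed

section \<open>Pucci operators in orthonormal frames\<close>

lemma poly_charpoly: "poly (charpoly M) x = det (\<chi> i j. (if i = j then x else 0) - M $ i $ j)"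
  unfolding charpoly_def det_def
  by (auto simp: poly_sum poly_prod intro!: sum.cong prod.cong arg_cong2[where f="(*)"])

text \<open>
  Both polynomials are compared at each real point \<open>x\<close>. The matrix whose columns are the
  frame conjugates \<open>x I - A\<close> to the diagonal matrix with entries \<open>x - e i\<close>, and the
  determinant does not see the conjugation.
\<close>

lemma charpoly_eigenframe:
  fixes A :: "real ^ 'n ^ 'n"
  assumes w: "orthonormal_frame w" and eig: "\<And>i. A *v w i = e i *\<^sub>R w i"
  shows "charpoly A = (\<Prod>i\<in>UNIV. [:- e i, 1:])"
proof (rule poly_eq_poly_eq_iff[THEN iffD1], rule ext)
  fix x
  let ?Q = "\<chi> i. w i" and ?M = "\<chi> i j. (if i = j then x else 0) - A $ i $ j"
  let ?D = "\<chi> i j. if i = j then x - e i else 0"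
  have Q: "?Q ** transpose ?Q = mat 1"
    using orthonormal_frame_matrix[OF w] by (simp add: orthogonal_matrix_def)
  have Mw: "?M *v w i = (x - e i) *\<^sub>R w i" for i
  proof -
    have "?M *v w i = x *\<^sub>R w i - A *v w i"
      by (simp add: vec_eq_iff matrix_vector_mult_def left_diff_distrib sum_subtractf if_distrib
          [where f="\<lambda>t. t * _"] cong: if_cong)
    then show ?thesis using eig by (simp add: scaleR_diff_left)
  qed
  have "?M ** transpose ?Q = transpose ?Q ** ?D"
  proof -
    have "(?M ** transpose ?Q) $ k $ i = (?M *v w i) $ k" for k i
      by (simp add: matrix_matrix_mult_def matrix_vector_mult_def transpose_def)
    moreover have "(transpose ?Q ** ?D) $ k $ i = (x - e i) * w i $ k" for k i
      by (simp add: matrix_matrix_mult_def transpose_def if_distrib cong: if_cong)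
    ultimately show ?thesis unfolding vec_eq_iff Mw by simp
  qed
  then have "det (?M ** transpose ?Q) = det (transpose ?Q ** ?D)"
    by (rule arg_cong)
  then have "det ?M * det (transpose ?Q) = det (transpose ?Q) * det ?D"
    unfolding det_mul .
  moreover have "det (transpose ?Q) \<noteq> 0"
    using arg_cong[OF Q, of det] unfolding det_mul det_I by auto
  ultimately have "det ?M = det ?D" by simp
  also have "\<dots> = (\<Prod>i\<in>UNIV. x - e i)" by (simp add: det_diagonal)
  finally show "poly (charpoly A) x = poly (\<Prod>i\<in>UNIV. [:- e i, 1:]) x"
    by (simp add: poly_charpoly poly_prod)
qed

lemma eigenvalues_eigenframe:
  fixes A :: "real ^ 'n ^ 'n"
  assumes "orthonormal_frame w" "\<And>i. A *v w i = e i *\<^sub>R w i"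
  shows "eigenvalues A = image_mset e (mset_set UNIV)"
  unfolding eigenvalues_def charpoly_eigenframe[OF assms]
  by (subst proots_prod) (auto simp: sum_unfold_sum_mset)

lemma sum_split_sign:
  fixes e :: "'n::finite \<Rightarrow> real"
  shows "a * (\<Sum>x\<in>#filter_mset (\<lambda>x. x > 0) (image_mset e (mset_set UNIV)). x)
       + b * (\<Sum>x\<in>#filter_mset (\<lambda>x. x < 0) (image_mset e (mset_set UNIV)). x)
       = (\<Sum>i\<in>UNIV. if e i > 0 then a * e i else b * e i)"
proof -
  have "(\<Sum>x\<in>#filter_mset P (image_mset e (mset_set UNIV)). x) = (\<Sum>i\<in>UNIV. if P (e i) then e i else 0)" for P
  proof -
    have "(\<Sum>x\<in>#filter_mset P (image_mset e (mset_set UNIV)). x) = (\<Sum>i | P (e i). e i)"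
      by (simp add: filter_mset_image_mset image_mset.compositionality sum_unfold_sum_mset comp_def)
    then show ?thesis by (simp add: sum.If_cases Int_def)
  qed
  then show ?thesis
    by (simp only: sum_distrib_left flip: sum.distrib) (intro sum.cong, auto)
qed

text \<open>
  The sign-dependent weights are rewritten as a minimum and a maximum of two linear functions.
  In this form concavity and convexity are visible, and this is all that the comparison
  argument uses about the Pucci operators.
\<close>

lemma pucci_eigenframe:
  fixes A :: "real ^ 'n ^ 'n"
  assumes "\<Lambda>1 \<le> \<Lambda>2" and "orthonormal_frame w" "\<And>i. A *v w i = e i *\<^sub>R w i"
  shows "pucci_min \<Lambda>1 \<Lambda>2 A = (\<Sum>i\<in>UNIV. min (\<Lambda>1 * e i) (\<Lambda>2 * e i))"
    and "pucci_max \<Lambda>1 \<Lambda>2 A = (\<Sum>i\<in>UNIV. max (\<Lambda>1 * e i) (\<Lambda>2 * e i))"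
  using assms(1)
  unfolding pucci_min_def pucci_max_def eigenvalues_eigenframe[OF assms(2,3)] sum_split_sign
  by (auto simp: min_def max_def mult_le_cancel_right intro!: sum.cong)

text \<open>
  Jensen's inequality. Each diagonal entry of \<open>A\<close> in the frame \<open>w\<close> is the average of the
  eigenvalues with weights \<open>(w j \<bullet> v i)\<^sup>2\<close>. The maximum of two linear functions is convex,
  and summing over \<open>j\<close> the weights of each eigenvalue add up to one by Parseval.
\<close>

lemma pucci_max_ge_frame_sum:
  fixes A :: "real ^ 'n ^ 'n"
  assumes le: "\<Lambda>1 \<le> \<Lambda>2" and sym: "transpose A = A" and w: "orthonormal_frame w"
  shows "(\<Sum>j\<in>UNIV. max (\<Lambda>1 * (w j \<bullet> (A *v w j))) (\<Lambda>2 * (w j \<bullet> (A *v w j)))) \<le> pucci_max \<Lambda>1 \<Lambda>2 A"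
proof -
  obtain v e where v: "orthonormal_frame v" and eig: "\<And>i. A *v v i = e i *\<^sub>R v i"
    using spectral_theorem_real[OF sym] by metis
  let ?p = "\<lambda>i j. (w j \<bullet> v i)\<^sup>2"
  have q: "w j \<bullet> (A *v w j) = (\<Sum>i\<in>UNIV. ?p i j * e i)" for j
    by (subst orthonormal_frame_parseval[OF v])
       (simp add: symmetric_matrix_inner[OF sym, symmetric] eig power2_eq_square mult_ac)
  have p1: "(\<Sum>j\<in>UNIV. ?p i j) = 1" for i
    using orthonormal_frame_parseval[OF w, of "v i" "v i"] v
    by (simp add: orthonormal_frame_def power2_eq_square inner_commute)
  have "max (\<Lambda>1 * (\<Sum>i\<in>UNIV. ?p i j * e i)) (\<Lambda>2 * (\<Sum>i\<in>UNIV. ?p i j * e i))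
        \<le> (\<Sum>i\<in>UNIV. ?p i j * max (\<Lambda>1 * e i) (\<Lambda>2 * e i))" for j
  proof -
    have "L * (\<Sum>i\<in>UNIV. ?p i j * e i) \<le> (\<Sum>i\<in>UNIV. ?p i j * max (\<Lambda>1 * e i) (\<Lambda>2 * e i))"
      if "L = \<Lambda>1 \<or> L = \<Lambda>2" for L
    proof -
      have "L * (\<Sum>i\<in>UNIV. ?p i j * e i) = (\<Sum>i\<in>UNIV. ?p i j * (L * e i))"
        by (simp add: sum_distrib_left mult_ac)
      also have "\<dots> \<le> (\<Sum>i\<in>UNIV. ?p i j * max (\<Lambda>1 * e i) (\<Lambda>2 * e i))"
        using that by (intro sum_mono mult_left_mono) auto
      finally show ?thesis .
    qed
    then show ?thesis by simp
  qed
  then have "(\<Sum>j\<in>UNIV. max (\<Lambda>1 * (w j \<bullet> (A *v w j))) (\<Lambda>2 * (w j \<bullet> (A *v w j))))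
     \<le> (\<Sum>j\<in>UNIV. \<Sum>i\<in>UNIV. ?p i j * max (\<Lambda>1 * e i) (\<Lambda>2 * e i))"
    unfolding q by (intro sum_mono)
  also have "\<dots> = (\<Sum>i\<in>UNIV. (\<Sum>j\<in>UNIV. ?p i j) * max (\<Lambda>1 * e i) (\<Lambda>2 * e i))"
    by (subst sum.swap) (simp add: sum_distrib_right)
  also have "\<dots> = pucci_max \<Lambda>1 \<Lambda>2 A"
    unfolding p1 pucci_eigenframe(2)[OF le v eig] by simp
  finally show ?thesis .
qed

definition outer :: "real ^ 'n \<Rightarrow> real ^ 'n \<Rightarrow> real ^ 'n ^ 'n" where
  "outer a b = (\<chi> i j. a $ i * b $ j)"

lemma outer_mult: "outer a b *v h = (b \<bullet> h) *\<^sub>R a"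
  by (simp add: outer_def vec_eq_iff matrix_vector_mult_def inner_vec_def sum_distrib_left mult_ac)

lemma transpose_outer: "transpose (outer a b) = outer b a"
  by (simp add: outer_def transpose_def vec_eq_iff mult.commute)

text \<open>
  In an eigenframe of the perturbed matrix, \<open>pucci_min\<close> is a sum of minima over the diagonal
  entries, and each entry splits into three contributions: the multiple \<open>- t\<close> of an entry of
  \<open>H\<close>, which costs at most \<open>t * pucci_max H\<close> by Jensen; the nonnegative rank-one part, whose
  entries sum to \<open>a \<bullet> a\<close> and enter with the smaller ellipticity constant; and the mixed
  terms, which are bounded crudely entry by entry, whence the factor \<open>CARD('n)\<close>.
  Working in one frame avoids ordering the eigenvalues of three different matrices.
\<close>

lemma pucci_min_perturbation:
  fixes H :: "real ^ 'n ^ 'n" and a d :: "real ^ 'n"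
  assumes L: "0 < \<Lambda>1" "\<Lambda>1 \<le> \<Lambda>2" and sym: "transpose H = H" and t: "0 \<le> t" and p: "0 \<le> p"
  shows "- t * pucci_max \<Lambda>1 \<Lambda>2 H + \<Lambda>1 * p * (a \<bullet> a) - 2 * \<Lambda>2 * \<bar>q\<bar> * real CARD('n) * norm a * norm d
    \<le> pucci_min \<Lambda>1 \<Lambda>2 ((- t) *\<^sub>R H + p *\<^sub>R outer a a + q *\<^sub>R (outer a d + outer d a))"
    (is "?lhs \<le> pucci_min \<Lambda>1 \<Lambda>2 ?X")
proof -
  have tp: "transpose (A + B) = transpose A + transpose B" "transpose (r *\<^sub>R A) = r *\<^sub>R transpose A"
    for A B :: "real ^ 'n ^ 'n" and r by (auto simp: transpose_def vec_eq_iff)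
  have "transpose ?X = ?X" by (simp add: tp sym transpose_outer add.commute del: scaleR_minus_left add_uminus_conv_diff)
  then obtain w e where w: "orthonormal_frame w" and eig: "\<And>i. ?X *v w i = e i *\<^sub>R w i"
    using spectral_theorem_real by metis
  let ?h = "\<lambda>j. w j \<bullet> (H *v w j)"
  have w1: "norm (w j) = 1" for j using w by (simp add: orthonormal_frame_def norm_eq_1)
  have e: "e j = - t * ?h j + p * (a \<bullet> w j)\<^sup>2 + 2 * q * ((a \<bullet> w j) * (d \<bullet> w j))" for j
  proof -
    have "e j = w j \<bullet> (?X *v w j)" using w unfolding eig by (simp add: orthonormal_frame_def)
    then show ?thesis
      by (simp add: matrix_vector_mult_add_rdistrib scaleR_matrix_vector_assoc[symmetric] outer_mult
          inner_simps power2_eq_square inner_commute algebra_simps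
          del: scaleR_minus_left add_uminus_conv_diff)
  qed
  have ptw: "min (\<Lambda>1 * e j) (\<Lambda>2 * e j) \<ge> - t * max (\<Lambda>1 * ?h j) (\<Lambda>2 * ?h j)
      + \<Lambda>1 * p * (a \<bullet> w j)\<^sup>2 - 2 * \<Lambda>2 * \<bar>q\<bar> * norm a * norm d" for j
  proof -
    let ?r = "2 * q * ((a \<bullet> w j) * (d \<bullet> w j))"
    have "\<bar>(a \<bullet> w j) * (d \<bullet> w j)\<bar> \<le> norm a * norm d"
      using Cauchy_Schwarz_ineq2[of a "w j"] Cauchy_Schwarz_ineq2[of d "w j"]
      by (simp add: abs_mult w1 mult_mono)
    then have "\<bar>q\<bar> * \<bar>(a \<bullet> w j) * (d \<bullet> w j)\<bar> \<le> \<bar>q\<bar> * (norm a * norm d)"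
      by (intro mult_left_mono) auto
    then have r: "\<bar>?r\<bar> \<le> 2 * \<bar>q\<bar> * norm a * norm d" by (simp add: abs_mult)
    have "- t * max (\<Lambda>1 * ?h j) (\<Lambda>2 * ?h j) + \<Lambda>1 * p * (a \<bullet> w j)\<^sup>2 - 2 * \<Lambda>2 * \<bar>q\<bar> * norm a * norm d
        \<le> L * e j" if L': "L = \<Lambda>1 \<or> L = \<Lambda>2" for L
    proof -
      have "t * (L * ?h j) \<le> t * max (\<Lambda>1 * ?h j) (\<Lambda>2 * ?h j)"
        using t L' by (intro mult_left_mono) auto
      moreover have "\<Lambda>1 * (p * (a \<bullet> w j)\<^sup>2) \<le> L * (p * (a \<bullet> w j)\<^sup>2)"
        using L L' p by (intro mult_right_mono) auto
      moreover have "L * \<bar>?r\<bar> \<le> \<Lambda>2 * (2 * \<bar>q\<bar> * norm a * norm d)"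
        using L L' r by (intro mult_mono) auto
      moreover have "- (L * ?r) \<le> L * \<bar>?r\<bar>"
        using L L' mult_left_mono[of "- ?r" "\<bar>?r\<bar>" L] by auto
      ultimately show ?thesis unfolding e by (simp add: algebra_simps)
    qed
    then show ?thesis by auto
  qed
  have aa: "(\<Sum>j\<in>UNIV. (a \<bullet> w j)\<^sup>2) = a \<bullet> a"
    using orthonormal_frame_parseval[OF w, of a a] by (simp add: power2_eq_square)
  have "?lhs \<le> - t * (\<Sum>j\<in>UNIV. max (\<Lambda>1 * ?h j) (\<Lambda>2 * ?h j)) + \<Lambda>1 * p * (a \<bullet> a)
     - 2 * \<Lambda>2 * \<bar>q\<bar> * real CARD('n) * norm a * norm d"
    using mult_left_mono[OF pucci_max_ge_frame_sum[OF L(2) sym w] t] by simp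
  also have "\<dots> = (\<Sum>j\<in>UNIV. - t * max (\<Lambda>1 * ?h j) (\<Lambda>2 * ?h j)
      + \<Lambda>1 * p * (a \<bullet> w j)\<^sup>2 - 2 * \<Lambda>2 * \<bar>q\<bar> * norm a * norm d)"
    by (simp add: sum.distrib sum_subtractf aa[symmetric] sum_distrib_left sum_negf)
  also have "\<dots> \<le> (\<Sum>j\<in>UNIV. min (\<Lambda>1 * e j) (\<Lambda>2 * e j))" by (intro sum_mono ptw)
  also have "\<dots> = pucci_min \<Lambda>1 \<Lambda>2 ?X" using pucci_eigenframe(1)[OF L(2) w eig] by simp
  finally show ?thesis .
qed

section \<open>First and second derivatives\<close>

text \<open>
  The functions \<open>gradient\<close> and \<open>hessian\<close> have values everywhere; the two introduction and two elimination
  lemmas here translate between these values and derivatives, so that the remaining calculus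
  uses only \<open>has_derivative\<close>.
\<close>

lemma has_derivative_gradient:
  fixes f :: "real ^ 'n \<Rightarrow> real"
  assumes "f differentiable (at x)"
  shows "(f has_derivative (\<lambda>h. gradient f x \<bullet> h)) (at x)"
proof -
  let ?D = "frechet_derivative f (at x)"
  have D: "(f has_derivative ?D) (at x)" using assms by (simp add: frechet_derivative_works)
  then have lin: "linear ?D" by (rule has_derivative_linear)
  have "?D h = gradient f x \<bullet> h" for h
  proof -
    have "?D h = ?D (\<Sum>i\<in>UNIV. h $ i *\<^sub>R axis i 1)"
      using basis_expansion[of h] by (simp add: scalar_mult_eq_scaleR)
    also have "\<dots> = (\<Sum>i\<in>UNIV. h $ i * ?D (axis i 1))"
      by (simp add: linear_sum[OF lin] linear_scale[OF lin])
    also have "\<dots> = gradient f x \<bullet> h"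
      by (simp add: gradient_def inner_vec_def mult.commute)
    finally show ?thesis .
  qed
  then have "?D = (\<lambda>h. gradient f x \<bullet> h)" by (rule ext)
  with D show ?thesis by simp
qed

lemma gradient_eqI:
  assumes "(f has_derivative (\<lambda>h. g \<bullet> h)) (at x)"
  shows "gradient f x = g"
  unfolding gradient_def frechet_derivative_at[OF assms, symmetric]
  by (simp add: vec_eq_iff inner_axis)

lemma has_derivative_hessian:
  assumes "gradient f differentiable (at x)"
  shows "(gradient f has_derivative (\<lambda>h. hessian f x *v h)) (at x)"
  using assms unfolding hessian_def jacobian_works .

lemma hessian_eqI:
  fixes f :: "real ^ 'n \<Rightarrow> real"
  assumes "open S" "x \<in> S"
    and "\<And>y. y \<in> S \<Longrightarrow> gradient f y = G y"
    and "(G has_derivative (\<lambda>h. H *v h)) (at x)"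
  shows "(gradient f has_derivative (\<lambda>h. H *v h)) (at x)" "hessian f x = H"
proof -
  show D: "(gradient f has_derivative (\<lambda>h. H *v h)) (at x)"
    using has_derivative_transform_within_open[OF assms(4,1,2)] assms(3) by auto
  show "hessian f x = H"
    unfolding hessian_def jacobian_def frechet_derivative_at[OF D, symmetric] by simp
qed

text \<open>
  The mean value theorem in direction \<open>b\<close> turns the second difference into \<open>s\<close> times a
  difference of two values of \<open>b \<bullet> gradient f\<close>, and differentiability of the gradient at
  the single point \<open>x\<close> evaluates that difference up to an error of order \<open>\<epsilon> s\<close>.
\<close>

lemma second_difference_asymptotics:
  fixes f :: "real ^ 'n \<Rightarrow> real" and a b :: "real ^ 'n"
  assumes S: "open S" "x \<in> S" and f: "\<And>y. y \<in> S \<Longrightarrow> f differentiable (at y)"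
    and H: "(gradient f has_derivative (\<lambda>h. H *v h)) (at x)" and "0 < \<epsilon>"
  shows "\<exists>d>0. \<forall>s. 0 < s \<and> s < d \<longrightarrow>
     \<bar>f (x + s *\<^sub>R a + s *\<^sub>R b) - f (x + s *\<^sub>R a) - f (x + s *\<^sub>R b) + f x - s\<^sup>2 * (b \<bullet> (H *v a))\<bar> \<le> \<epsilon> * s\<^sup>2"
proof -
  let ?N = "norm a + norm b + 1"
  let ?R = "\<lambda>h. gradient f (x + h) - gradient f x - H *v h"
  define \<eta> where "\<eta> = \<epsilon> / (2 * ?N * ?N)"
  have N: "?N > 0" by (simp add: add_nonneg_pos)
  then have "\<eta> > 0" using \<open>0 < \<epsilon>\<close> by (simp add: \<eta>_def)
  then obtain r where r: "r > 0" and "\<And>y. norm (y - x) < r \<Longrightarrow>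
      norm (gradient f y - gradient f x - H *v (y - x)) \<le> \<eta> * norm (y - x)"
    using H unfolding has_derivative_at_alt by blast
  then have R: "norm (?R h) \<le> \<eta> * norm h" if "norm h < r" for h
    using that by (metis add_diff_cancel_left')
  obtain r' where r': "r' > 0" "ball x r' \<subseteq> S" using S by (meson openE)
  define d where "d = min r r' / ?N"
  have "d > 0" using r r' N by (simp add: d_def)
  moreover have "\<bar>f (x + s *\<^sub>R a + s *\<^sub>R b) - f (x + s *\<^sub>R a) - f (x + s *\<^sub>R b) + f x - s\<^sup>2 * (b \<bullet> (H *v a))\<bar> \<le> \<epsilon> * s\<^sup>2"
    if s: "0 < s" "s < d" for s
  proof -
    have sN: "s * ?N < min r r'" using s N by (simp add: d_def pos_less_divide_eq)
    have small: "norm (\<sigma> *\<^sub>R a + \<tau> *\<^sub>R b) \<le> s * ?N" if "0 \<le> \<sigma>" "\<sigma> \<le> s" "0 \<le> \<tau>" "\<tau> \<le> s" for \<sigma> \<tau>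
    proof -
      have "norm (\<sigma> *\<^sub>R a + \<tau> *\<^sub>R b) \<le> \<sigma> * norm a + \<tau> * norm b"
        using norm_triangle_ineq[of "\<sigma> *\<^sub>R a" "\<tau> *\<^sub>R b"] that by simp
      also have "\<dots> \<le> s * norm a + s * norm b" using that by (intro add_mono mult_right_mono) auto
      finally show ?thesis using s by (simp add: algebra_simps)
    qed
    have inS: "x + (\<sigma> *\<^sub>R a + \<tau> *\<^sub>R b) \<in> S" if "0 \<le> \<sigma>" "\<sigma> \<le> s" "0 \<le> \<tau>" "\<tau> \<le> s" for \<sigma> \<tau>
    proof -
      have "dist x (x + (\<sigma> *\<^sub>R a + \<tau> *\<^sub>R b)) < r'"
        using order.strict_trans1[OF small[OF that] sN]
        by (metis add_diff_cancel_left' dist_commute dist_norm min_less_iff_conj)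
      then show ?thesis using r' by auto
    qed
    let ?k = "\<lambda>\<tau>. f (x + (s *\<^sub>R a + \<tau> *\<^sub>R b)) - f (x + (0 *\<^sub>R a + \<tau> *\<^sub>R b))"
    let ?k' = "\<lambda>\<tau>. b \<bullet> (gradient f (x + (s *\<^sub>R a + \<tau> *\<^sub>R b)) - gradient f (x + (0 *\<^sub>R a + \<tau> *\<^sub>R b)))"
    have der: "((\<lambda>\<tau>. f (x + (\<sigma> *\<^sub>R a + \<tau> *\<^sub>R b))) has_real_derivative b \<bullet> gradient f (x + (\<sigma> *\<^sub>R a + \<tau> *\<^sub>R b))) (at \<tau>)"
      if "0 \<le> \<sigma>" "\<sigma> \<le> s" "0 \<le> \<tau>" "\<tau> \<le> s" for \<sigma> \<tau>
    proof -
      have "((\<lambda>\<tau>. x + (\<sigma> *\<^sub>R a + \<tau> *\<^sub>R b)) has_derivative (\<lambda>t. t *\<^sub>R b)) (at \<tau>)"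
        by (auto intro!: derivative_eq_intros)
      from has_derivative_compose[OF this has_derivative_gradient[OF f[OF inS[OF that]]]]
      show ?thesis by (simp add: has_field_derivative_def inner_commute mult_commute_abs)
    qed
    have "(?k has_real_derivative ?k' \<tau>) (at \<tau>)" if "0 \<le> \<tau>" "\<tau> \<le> s" for \<tau>
      unfolding inner_diff_right using that s by (intro DERIV_diff der) auto
    from MVT2[OF s(1) this] obtain \<tau> where \<tau>: "0 < \<tau>" "\<tau> < s" "?k s - ?k 0 = s * ?k' \<tau>"
      by auto
    let ?u = "s *\<^sub>R a + \<tau> *\<^sub>R b" and ?v = "0 *\<^sub>R a + \<tau> *\<^sub>R b"
    have Ru: "norm (?R ?u) \<le> \<eta> * (s * ?N)" and Rv: "norm (?R ?v) \<le> \<eta> * (s * ?N)"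
      using small[of s \<tau>] small[of 0 \<tau>] \<tau> s sN R[of ?u] R[of ?v] \<open>\<eta> > 0\<close>
      by (auto intro!: order_trans[OF R] mult_left_mono)
    have "?k' \<tau> - s * (b \<bullet> (H *v a)) = b \<bullet> (?R ?u - ?R ?v)"
      by (simp add: inner_simps matrix_vector_right_distrib linear_scale[OF matrix_vector_mul_linear])
    also have "\<bar>\<dots>\<bar> \<le> norm b * norm (?R ?u - ?R ?v)" by (rule Cauchy_Schwarz_ineq2)
    also have "\<dots> \<le> ?N * (2 * (\<eta> * (s * ?N)))"
    proof (rule mult_mono)
      show "norm (?R ?u - ?R ?v) \<le> 2 * (\<eta> * (s * ?N))"
        using norm_triangle_ineq4[of "?R ?u" "?R ?v"] Ru Rv by linarith
    qed (auto simp: add_nonneg_nonneg)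
    also have "\<dots> = \<epsilon> * s"
    proof -
      have "n * (2 * (\<epsilon> / (2 * n * n) * (s * n))) = \<epsilon> * s" if "n > 0" for n :: real
        using that by (simp add: field_simps)
      from this[OF N] show ?thesis by (simp only: \<eta>_def)
    qed
    finally have k': "\<bar>?k' \<tau> - s * (b \<bullet> (H *v a))\<bar> \<le> \<epsilon> * s" .
    have "f (x + s *\<^sub>R a + s *\<^sub>R b) - f (x + s *\<^sub>R a) - f (x + s *\<^sub>R b) + f x - s\<^sup>2 * (b \<bullet> (H *v a))
      = (?k s - ?k 0) - s\<^sup>2 * (b \<bullet> (H *v a))" by (simp add: add.assoc)
    also have "\<dots> = s * (?k' \<tau> - s * (b \<bullet> (H *v a)))"
      unfolding \<tau>(3) by (simp add: power2_eq_square algebra_simps)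
    also have "\<bar>\<dots>\<bar> \<le> s * (\<epsilon> * s)"
      using mult_left_mono[OF k', of s] s by (simp add: abs_mult)
    finally show ?thesis by (simp add: power2_eq_square mult_ac)
  qed
  ultimately show ?thesis by blast
qed

text \<open>
  The second difference does not change when \<open>a\<close> and \<open>b\<close> are exchanged, so its two
  leading coefficients \<open>b \<bullet> H a\<close> and \<open>a \<bullet> H b\<close> coincide.
\<close>

lemma hessian_symmetric:
  fixes f :: "real ^ 'n \<Rightarrow> real"
  assumes S: "open S" "x \<in> S" and f: "C2_on S f"
  shows "transpose (hessian f x) = hessian f x"
proof -
  let ?H = "hessian f x"
  have H: "(gradient f has_derivative (\<lambda>h. ?H *v h)) (at x)"
    using f S by (intro has_derivative_hessian) (auto simp: C2_on_def)
  have df: "f differentiable (at y)" if "y \<in> S" for y using f that by (auto simp: C2_on_def)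
  have "b \<bullet> (?H *v a) = a \<bullet> (?H *v b)" for a b
  proof (rule ccontr)
    assume ne: "b \<bullet> (?H *v a) \<noteq> a \<bullet> (?H *v b)"
    define \<epsilon> where "\<epsilon> = \<bar>b \<bullet> (?H *v a) - a \<bullet> (?H *v b)\<bar> / 3"
    have "\<epsilon> > 0" using ne by (simp add: \<epsilon>_def)
    obtain d1 d2 where d: "d1 > 0" "d2 > 0"
      and 1: "\<And>s. 0 < s \<Longrightarrow> s < d1 \<Longrightarrow> \<bar>f (x + s *\<^sub>R a + s *\<^sub>R b) - f (x + s *\<^sub>R a) - f (x + s *\<^sub>R b) + f x
          - s\<^sup>2 * (b \<bullet> (?H *v a))\<bar> \<le> \<epsilon> * s\<^sup>2"
      and 2: "\<And>s. 0 < s \<Longrightarrow> s < d2 \<Longrightarrow> \<bar>f (x + s *\<^sub>R b + s *\<^sub>R a) - f (x + s *\<^sub>R b) - f (x + s *\<^sub>R a) + f x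
          - s\<^sup>2 * (a \<bullet> (?H *v b))\<bar> \<le> \<epsilon> * s\<^sup>2"
      using second_difference_asymptotics[OF S df H \<open>\<epsilon> > 0\<close>, of a b]
        second_difference_asymptotics[OF S df H \<open>\<epsilon> > 0\<close>, of b a] by blast
    define s where "s = min d1 d2 / 2"
    have s: "0 < s" "s < d1" "s < d2" using d by (auto simp: s_def)
    have "x + s *\<^sub>R b + s *\<^sub>R a = x + s *\<^sub>R a + s *\<^sub>R b" by simp
    then have "\<bar>s\<^sup>2 * (b \<bullet> (?H *v a)) - s\<^sup>2 * (a \<bullet> (?H *v b))\<bar> \<le> 2 * (\<epsilon> * s\<^sup>2)"
      using 1[OF s(1,2)] 2[OF s(1,3)] unfolding \<open>x + s *\<^sub>R b + s *\<^sub>R a = _\<close> by linarith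
    then have "s\<^sup>2 * (3 * \<epsilon>) \<le> s\<^sup>2 * (2 * \<epsilon>)"
      unfolding \<epsilon>_def right_diff_distrib[symmetric] abs_mult by simp
    then show False using s(1) \<open>\<epsilon> > 0\<close> by simp
  qed
  from this[of "axis _ 1" "axis _ 1"] show ?thesis
    by (simp add: vec_eq_iff transpose_def matrix_vector_mul_component inner_axis inner_axis')
qed

lemma C2_on_continuous_gradient:
  assumes "C2_on S f"
  shows "continuous_on S f" "continuous_on S (gradient f)"
  using assms unfolding C2_on_def
  by (auto intro!: continuous_at_imp_continuous_on differentiable_imp_continuous_within)

lemma C2_product_rules:
  fixes f g :: "real ^ 'n \<Rightarrow> real"
  assumes S: "open S" and f: "C2_on S f" and g: "C2_on S g"
  shows gradient_mult: "x \<in> S \<Longrightarrow> gradient (\<lambda>y. f y * g y) x = f x *\<^sub>R gradient g x + g x *\<^sub>R gradient f x"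
    and hessian_mult: "x \<in> S \<Longrightarrow> hessian (\<lambda>y. f y * g y) x =
      f x *\<^sub>R hessian g x + g x *\<^sub>R hessian f x + (outer (gradient g x) (gradient f x) + outer (gradient f x) (gradient g x))"
    and C2_on_mult: "C2_on S (\<lambda>y. f y * g y)"
proof -
  let ?G = "\<lambda>x. f x *\<^sub>R gradient g x + g x *\<^sub>R gradient f x"
  let ?H = "\<lambda>x. f x *\<^sub>R hessian g x + g x *\<^sub>R hessian f x
    + (outer (gradient g x) (gradient f x) + outer (gradient f x) (gradient g x))"
  note D = f[unfolded C2_on_def] g[unfolded C2_on_def]
  have df: "(f has_derivative (\<lambda>h. gradient f x \<bullet> h)) (at x)"
    and dg: "(g has_derivative (\<lambda>h. gradient g x \<bullet> h)) (at x)" if "x \<in> S" for x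
    using D that by (auto intro: has_derivative_gradient)
  have ddf: "(gradient f has_derivative (\<lambda>h. hessian f x *v h)) (at x)"
    and ddg: "(gradient g has_derivative (\<lambda>h. hessian g x *v h)) (at x)" if "x \<in> S" for x
    using D that by (auto intro: has_derivative_hessian)
  have d: "((\<lambda>y. f y * g y) has_derivative (\<lambda>h. ?G x \<bullet> h)) (at x)" if "x \<in> S" for x
    using has_derivative_mult[OF df[OF that] dg[OF that]]
    by (simp add: inner_simps mult.commute)
  show G: "gradient (\<lambda>y. f y * g y) x = ?G x" if "x \<in> S" for x
    using d[OF that] by (rule gradient_eqI)
  have "(?G has_derivative (\<lambda>h. ?H x *v h)) (at x)" if "x \<in> S" for x
  proof -
    have "(?G has_derivative (\<lambda>h. (f x *\<^sub>R (hessian g x *v h) + (gradient f x \<bullet> h) *\<^sub>R gradient g x)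
        + (g x *\<^sub>R (hessian f x *v h) + (gradient g x \<bullet> h) *\<^sub>R gradient f x))) (at x)"
      using that by (intro has_derivative_add has_derivative_scaleR df dg ddf ddg)
    then show ?thesis
      by (simp add: matrix_vector_mult_add_rdistrib scaleR_matrix_vector_assoc[symmetric] outer_mult add_ac)
  qed
  from hessian_eqI[OF S _ G this]
  have H: "(gradient (\<lambda>y. f y * g y) has_derivative (\<lambda>h. ?H x *v h)) (at x)"
    "hessian (\<lambda>y. f y * g y) x = ?H x" if "x \<in> S" for x
    using that by blast+
  then show "hessian (\<lambda>y. f y * g y) x = ?H x" if "x \<in> S" for x using that by blast
  have "continuous_on S ?H"
    using D unfolding outer_def
    by (intro continuous_intros C2_on_continuous_gradient[OF f] C2_on_continuous_gradient[OF g]) auto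
  then have "continuous_on S (hessian (\<lambda>y. f y * g y))"
    using H(2) by (simp cong: continuous_on_cong)
  then show "C2_on S (\<lambda>y. f y * g y)"
    using d H(1) unfolding C2_on_def differentiable_def by blast
qed

text \<open>
  The exponential is the barrier because its second derivative in direction \<open>b\<close> exceeds its
  first derivative by a factor \<open>norm b\<close>, which can be made as large as desired.
\<close>

lemma exponential_barrier:
  fixes b :: "real ^ 'n"
  shows gradient_exp_barrier: "gradient (\<lambda>x. \<epsilon> * exp (b \<bullet> x) - k) x = (\<epsilon> * exp (b \<bullet> x)) *\<^sub>R b"
    and hessian_exp_barrier: "hessian (\<lambda>x. \<epsilon> * exp (b \<bullet> x) - k) x = (\<epsilon> * exp (b \<bullet> x)) *\<^sub>R outer b b"
    and C2_on_exp_barrier: "C2_on S (\<lambda>x. \<epsilon> * exp (b \<bullet> x) - k)"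
proof -
  let ?v = "\<lambda>x. \<epsilon> * exp (b \<bullet> x) - k"
  have d: "(?v has_derivative (\<lambda>h. ((\<epsilon> * exp (b \<bullet> x)) *\<^sub>R b) \<bullet> h)) (at x)" for x
    by (auto intro!: derivative_eq_intros)
  show G: "gradient ?v x = (\<epsilon> * exp (b \<bullet> x)) *\<^sub>R b" for x
    using d by (rule gradient_eqI)
  have "((\<lambda>x. (\<epsilon> * exp (b \<bullet> x)) *\<^sub>R b) has_derivative (\<lambda>h. ((\<epsilon> * exp (b \<bullet> x)) *\<^sub>R outer b b) *v h)) (at x)" for x
    by (auto intro!: derivative_eq_intros simp: scaleR_matrix_vector_assoc[symmetric] outer_mult)
  from hessian_eqI[OF open_UNIV UNIV_I G this]
  have H: "(gradient ?v has_derivative (\<lambda>h. ((\<epsilon> * exp (b \<bullet> x)) *\<^sub>R outer b b) *v h)) (at x)"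
    "hessian ?v x = (\<epsilon> * exp (b \<bullet> x)) *\<^sub>R outer b b" for x by blast+
  show "hessian ?v x = (\<epsilon> * exp (b \<bullet> x)) *\<^sub>R outer b b" by (rule H)
  have "hessian ?v = (\<lambda>x. (\<epsilon> * exp (b \<bullet> x)) *\<^sub>R outer b b)" using H(2) by blast
  then have "continuous_on S (hessian ?v)" by (auto intro!: continuous_intros)
  then show "C2_on S ?v" using d H(1) unfolding C2_on_def differentiable_def by blast
qed

section \<open>The comparison argument\<close>

lemma C1_closure_bounded_gradient:
  assumes "bounded S" and "C1_closure S f"
  obtains K where "0 \<le> K" "\<And>x. x \<in> S \<Longrightarrow> norm (gradient f x) \<le> K"
proof -
  obtain G where G: "continuous_on (closure S) G" "\<And>x. x \<in> S \<Longrightarrow> G x = gradient f x"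
    using assms(2) by (auto simp: C1_closure_def)
  have "bounded (G ` closure S)"
    using assms(1) by (intro compact_imp_bounded compact_continuous_image G) simp
  then obtain K where "\<And>x. x \<in> closure S \<Longrightarrow> norm (G x) \<le> K"
    unfolding bounded_iff by blast
  then have K: "norm (gradient f x) \<le> K" if "x \<in> S" for x
    using that G(2) closure_subset by fastforce
  show thesis by (rule that[of "max K 0"]) (auto intro: max.coboundedI1 K)
qed

text \<open>
  Minimise \<open>u / \<psi> - \<epsilon> * g\<close> over the compact closure. With \<open>\<epsilon>\<close> so small that \<open>\<epsilon> * g\<close> is
  at most half of the depth \<open>- u z / \<psi> z\<close>, the minimiser still has \<open>u < 0\<close>, so it is not on
  the boundary; \<open>- k\<close> is the minimal value.
\<close>

lemma touching_point:
  fixes \<Omega> :: "(real ^ 'n) set" and \<psi> u g :: "real ^ 'n \<Rightarrow> real"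
  assumes "bounded \<Omega>" and cont: "continuous_on (closure \<Omega>) u" "continuous_on (closure \<Omega>) \<psi>" "continuous_on (closure \<Omega>) g"
    and \<psi>: "\<And>x. x \<in> closure \<Omega> \<Longrightarrow> 0 < \<psi> x" and g: "\<And>x. 0 < g x"
    and bd: "\<And>x. x \<in> frontier \<Omega> \<Longrightarrow> 0 \<le> u x" and z: "z \<in> \<Omega>" "u z < 0"
  obtains x0 \<epsilon> k where "x0 \<in> \<Omega>" "u x0 < 0" "0 < \<epsilon>" "u x0 = \<psi> x0 * (\<epsilon> * g x0 - k)"
    "\<And>x. x \<in> \<Omega> \<Longrightarrow> \<psi> x * (\<epsilon> * g x - k) \<le> u x"
proof -
  define w where "w x = u x / \<psi> x" for x
  have cpt: "compact (closure \<Omega>)" using assms(1) by simp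
  have zc: "z \<in> closure \<Omega>" using z closure_subset by blast
  have ne: "closure \<Omega> \<noteq> {}" using zc by auto
  obtain y where y: "\<And>x. x \<in> closure \<Omega> \<Longrightarrow> g x \<le> g y"
    using continuous_attains_sup[OF cpt ne cont(3)] by blast
  define \<epsilon> where "\<epsilon> = - w z / (2 * g y)"
  have wz: "w z < 0" using z(2) \<psi>[OF zc] by (simp add: w_def divide_neg_pos)
  have \<epsilon>: "\<epsilon> > 0" unfolding \<epsilon>_def using wz g[of y] by (intro divide_pos_pos) auto
  have "continuous_on (closure \<Omega>) (\<lambda>x. w x - \<epsilon> * g x)"
    unfolding w_def by (intro continuous_intros cont ballI less_imp_neq[THEN not_sym] \<psi>)
  then obtain x0 where x0: "x0 \<in> closure \<Omega>"
    and min: "\<And>x. x \<in> closure \<Omega> \<Longrightarrow> w x0 - \<epsilon> * g x0 \<le> w x - \<epsilon> * g x"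
    using continuous_attains_inf[OF cpt ne] by blast
  have "\<epsilon> * g x0 \<le> \<epsilon> * g y" using y[OF x0] \<epsilon> by (intro mult_left_mono) auto
  also have "\<dots> = - w z / 2" using g[of y] by (simp add: \<epsilon>_def field_simps)
  finally have "w x0 < 0" using min[OF zc] wz mult_pos_pos[OF \<epsilon> g[of z]] by linarith
  then have neg: "u x0 < 0" using \<psi>[OF x0] by (simp add: w_def divide_less_0_iff)
  define k where "k = \<epsilon> * g x0 - w x0"
  have "x0 \<in> \<Omega>" using x0 neg bd[of x0] interior_subset[of \<Omega>] unfolding frontier_def by force
  moreover have "u x0 = \<psi> x0 * (\<epsilon> * g x0 - k)" using \<psi>[OF x0] by (simp add: k_def w_def)
  moreover have "\<psi> x * (\<epsilon> * g x - k) \<le> u x" if "x \<in> \<Omega>" for x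
  proof -
    have xc: "x \<in> closure \<Omega>" using that closure_subset by blast
    have "\<epsilon> * g x - k \<le> u x / \<psi> x" using min[OF xc] by (simp add: k_def w_def[symmetric])
    then show ?thesis using \<psi>[OF xc] by (simp add: pos_le_divide_eq mult.commute)
  qed
  ultimately show thesis using that neg \<epsilon> by blast
qed

text \<open>
  Write \<open>\<phi> = \<psi> * v\<close> with \<open>v x = - t < 0\<close>. The terms without derivatives of \<open>v\<close> add up to
  \<open>- t\<close> times \<open>pucci_max (D\<^sup>2\<psi>) + \<gamma> * norm (D\<psi>) + c * \<psi>\<close>, which is at most \<open>0\<close> precisely by the
  supersolution property of \<open>\<psi>\<close> and the bound on \<open>c\<close>. What remains is \<open>E * norm b\<close> times
  the gap in the condition on \<open>norm b\<close>: the convexity of the exponential beats the mixed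
  second-order terms and the first-order term.
\<close>

lemma barrier_strict_subsolution:
  fixes \<psi> :: "real ^ 'n \<Rightarrow> real" and b x :: "real ^ 'n"
  assumes L: "0 < \<Lambda>1" "\<Lambda>1 \<le> \<Lambda>2" and S: "open S" "x \<in> S" and C2: "C2_on S \<psi>"
    and pos: "0 < \<psi> x" and "0 \<le> \<gamma>"
    and sup: "pucci_max \<Lambda>1 \<Lambda>2 (hessian \<psi> x) + l * \<psi> x \<le> 0"
    and c: "c \<le> l - \<gamma> * (norm (gradient \<psi> x) / \<psi> x)"
    and \<epsilon>: "0 < \<epsilon>" and neg: "\<epsilon> * exp (b \<bullet> x) - k < 0"
    and b: "b \<noteq> 0" "\<gamma> * \<psi> x + 2 * \<Lambda>2 * real CARD('n) * norm (gradient \<psi> x) < \<Lambda>1 * \<psi> x * norm b"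
  defines "\<phi> \<equiv> \<lambda>y. \<psi> y * (\<epsilon> * exp (b \<bullet> y) - k)"
  shows "0 < pucci_min \<Lambda>1 \<Lambda>2 (hessian \<phi> x) - \<gamma> * norm (gradient \<phi> x) + c * \<phi> x"
proof -
  define E where "E = \<epsilon> * exp (b \<bullet> x)"
  define t where "t = k - E"
  let ?P = "pucci_max \<Lambda>1 \<Lambda>2 (hessian \<psi> x)" and ?d = "gradient \<psi> x" and ?N = "real CARD('n)"
  have E: "E > 0" and t: "t > 0" using \<epsilon> neg by (auto simp: E_def t_def)
  have v: "\<epsilon> * exp (b \<bullet> x) - k = - t" by (simp add: t_def E_def)
  have G: "gradient \<phi> x = \<psi> x *\<^sub>R (E *\<^sub>R b) + (- t) *\<^sub>R ?d"
    unfolding \<phi>_def by (subst gradient_mult[OF S(1) C2 C2_on_exp_barrier S(2)])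
      (simp only: gradient_exp_barrier v E_def)
  have H: "hessian \<phi> x = (- t) *\<^sub>R hessian \<psi> x + (\<psi> x * E) *\<^sub>R outer b b + E *\<^sub>R (outer b ?d + outer ?d b)"
  proof -
    have "outer (E *\<^sub>R b) ?d + outer ?d (E *\<^sub>R b) = E *\<^sub>R (outer b ?d + outer ?d b)"
      by (simp add: outer_def vec_eq_iff algebra_simps)
    then show ?thesis
      unfolding \<phi>_def hessian_mult[OF S(1) C2 C2_on_exp_barrier S(2)]
        hessian_exp_barrier gradient_exp_barrier E_def[symmetric]
      by (simp add: v[folded E_def] add_ac)
  qed
  have "norm (gradient \<phi> x) \<le> \<psi> x * E * norm b + t * norm ?d"
    unfolding G using pos E t by (intro norm_triangle_le) simp
  then have gr: "\<gamma> * norm (gradient \<phi> x) \<le> \<gamma> * (\<psi> x * E * norm b + t * norm ?d)"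
    using \<open>0 \<le> \<gamma>\<close> by (rule mult_left_mono)
  have "- t * ?P + \<Lambda>1 * (\<psi> x * E) * (b \<bullet> b) - 2 * \<Lambda>2 * \<bar>E\<bar> * ?N * norm b * norm ?d
      \<le> pucci_min \<Lambda>1 \<Lambda>2 (hessian \<phi> x)"
    unfolding H using pos E t by (intro pucci_min_perturbation L hessian_symmetric[OF S C2]) auto
  then have M: "- t * ?P + \<Lambda>1 * (\<psi> x * E) * (norm b)\<^sup>2 - 2 * \<Lambda>2 * E * ?N * norm b * norm ?d
      \<le> pucci_min \<Lambda>1 \<Lambda>2 (hessian \<phi> x)"
    using E by (simp add: dot_square_norm)
  have "c * \<psi> x \<le> (l - \<gamma> * (norm ?d / \<psi> x)) * \<psi> x"
    using c pos by (intro mult_right_mono) auto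
  then have "?P + \<gamma> * norm ?d + c * \<psi> x \<le> 0"
    using sup pos by (simp add: left_diff_distrib)
  then have A: "t * (?P + \<gamma> * norm ?d + c * \<psi> x) \<le> 0"
    using t by (simp add: mult_nonneg_nonpos)
  \<comment> \<open>The strict gain of the barrier, the only place where strictness arises.\<close>
  have "0 < E * norm b * (\<Lambda>1 * \<psi> x * norm b - 2 * \<Lambda>2 * ?N * norm ?d - \<gamma> * \<psi> x)"
    using E b by (intro mult_pos_pos) auto
  moreover have "c * \<phi> x = - (t * (c * \<psi> x))" by (simp add: \<phi>_def v)
  ultimately show ?thesis using A M gr by (simp add: algebra_simps power2_eq_square)
qed

theorem theorem2:
  fixes \<Lambda>1 \<Lambda>2 \<gamma> :: real
    and \<Omega> :: "(real ^ 'n) set"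
    and lam c \<psi> u :: "real ^ 'n \<Rightarrow> real"
  assumes "0 < \<Lambda>1" and "\<Lambda>1 \<le> \<Lambda>2"
    and "open \<Omega>" and "connected \<Omega>" and "\<Omega> \<noteq> {}" and "bounded \<Omega>"
    and "Linfty \<Omega> lam" and "Linfty \<Omega> c" and "0 \<le> \<gamma>"
    and "C2_on \<Omega> \<psi>" and "C1_closure \<Omega> \<psi>"
    and "\<And>x. x \<in> closure \<Omega> \<Longrightarrow> 0 < \<psi> x"
    and "\<And>x. x \<in> \<Omega> \<Longrightarrow> pucci_max \<Lambda>1 \<Lambda>2 (hessian \<psi> x) + lam x * \<psi> x \<le> 0"
    and "continuous_on (closure \<Omega>) u"
    and "viscosity_le_zero (\<lambda>x r p X. pucci_min \<Lambda>1 \<Lambda>2 X - \<gamma> * norm p + c x * r) \<Omega> u"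
    and "\<And>x. x \<in> frontier \<Omega> \<Longrightarrow> 0 \<le> u x"
    and "\<And>x. x \<in> \<Omega> \<Longrightarrow> c x \<le> lam x - \<gamma> * (norm (gradient \<psi> x) / \<psi> x)"
  shows "\<forall>x\<in>\<Omega>. 0 \<le> u x"
proof (rule ccontr)
  assume "\<not> (\<forall>x\<in>\<Omega>. 0 \<le> u x)"
  then obtain z where z: "z \<in> \<Omega>" "u z < 0" by (auto simp: not_le)
  have cont: "continuous_on (closure \<Omega>) \<psi>" using \<open>C1_closure \<Omega> \<psi>\<close> by (simp add: C1_closure_def)
  have cpt: "compact (closure \<Omega>)" using \<open>bounded \<Omega>\<close> by simp
  obtain y where y: "y \<in> closure \<Omega>" "\<And>x. x \<in> closure \<Omega> \<Longrightarrow> \<psi> y \<le> \<psi> x"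
    using continuous_attains_inf[OF cpt _ cont] \<open>\<Omega> \<noteq> {}\<close> by auto
  define m where "m = \<psi> y"
  have m: "0 < m" using assms(12)[OF y(1)] by (simp add: m_def)
  obtain K where K: "0 \<le> K" "\<And>x. x \<in> \<Omega> \<Longrightarrow> norm (gradient \<psi> x) \<le> K"
    using C1_closure_bounded_gradient[OF \<open>bounded \<Omega>\<close> \<open>C1_closure \<Omega> \<psi>\<close>] by blast
  \<comment> \<open>The largest possible size of the mixed second-order terms, per unit of the barrier derivative.\<close>
  define Q where "Q = 2 * \<Lambda>2 * real CARD('n) * K"
  have Q: "0 \<le> Q" using assms(1,2) K by (simp add: Q_def)
  \<comment> \<open>Since psi is at least m, a slope of this length dominates Q and the drift; the 1 gives strictness.\<close>
  have r: "0 < (\<gamma> + Q / m + 1) / \<Lambda>1"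
    using assms(1,9) Q m by (intro divide_pos_pos add_nonneg_pos) auto
  obtain b :: "real ^ 'n" where nb: "norm b = (\<gamma> + Q / m + 1) / \<Lambda>1"
    using vector_choose_size[OF less_imp_le[OF r]] by metis
  have b0: "b \<noteq> 0" using nb r by auto
  have "continuous_on (closure \<Omega>) (\<lambda>x. exp (b \<bullet> x))" by (intro continuous_intros)
  then obtain x0 \<epsilon> k where x0: "x0 \<in> \<Omega>" "u x0 < 0" "0 < \<epsilon>" "u x0 = \<psi> x0 * (\<epsilon> * exp (b \<bullet> x0) - k)"
    and touch: "\<And>x. x \<in> \<Omega> \<Longrightarrow> \<psi> x * (\<epsilon> * exp (b \<bullet> x) - k) \<le> u x"
    by (rule touching_point[OF \<open>bounded \<Omega>\<close> assms(14) cont _ assms(12) exp_gt_zero assms(16) z]) blast+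
  have x0c: "x0 \<in> closure \<Omega>" using x0 closure_subset by blast
  have pos: "0 < \<psi> x0" by (rule assms(12)[OF x0c])
  let ?\<phi> = "\<lambda>y. \<psi> y * (\<epsilon> * exp (b \<bullet> y) - k)"
  have "\<gamma> * \<psi> x0 + 2 * \<Lambda>2 * real CARD('n) * norm (gradient \<psi> x0) < \<Lambda>1 * \<psi> x0 * norm b"
  proof -
    have "2 * \<Lambda>2 * real CARD('n) * norm (gradient \<psi> x0) \<le> Q"
      unfolding Q_def using assms(1,2) K(2)[OF x0(1)] by (intro mult_left_mono) auto
    also have "Q = Q / m * m" using m by simp
    also have "\<dots> \<le> Q / m * \<psi> x0" using y(2)[OF x0c] Q m by (intro mult_left_mono) (auto simp: m_def)
    finally have "\<gamma> * \<psi> x0 + 2 * \<Lambda>2 * real CARD('n) * norm (gradient \<psi> x0) < (\<gamma> + Q / m + 1) * \<psi> x0"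
      using pos by (simp add: algebra_simps)
    also have "\<dots> = \<Lambda>1 * \<psi> x0 * norm b" unfolding nb using assms(1) by simp
    finally show ?thesis .
  qed
  then have "0 < pucci_min \<Lambda>1 \<Lambda>2 (hessian ?\<phi> x0) - \<gamma> * norm (gradient ?\<phi> x0) + c x0 * ?\<phi> x0"
    using x0 pos b0
    by (intro barrier_strict_subsolution[OF assms(1,2,3) x0(1) assms(10) pos assms(9)
          assms(13)[OF x0(1)] assms(17)[OF x0(1)]]) (auto simp: mult_less_0_iff)
  moreover have "C2_on \<Omega> ?\<phi>"
    by (rule C2_on_mult[OF assms(3,10) C2_on_exp_barrier])
  \<comment> \<open>The test function touches u from below, so u minus it has its minimum, zero, at x0.\<close>
  moreover have "\<forall>\<^sub>F y in at x0 within \<Omega>. u x0 - ?\<phi> x0 \<le> u y - ?\<phi> y"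
    using touch x0(4) by (auto simp: eventually_at_filter)
  ultimately show False
    using assms(15) x0(1,4) unfolding viscosity_le_zero_def by force
qed

end
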